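(* Let $d\ge1$ be an integer, $p\ge1$ a real number, and $f\in C_c^1(\mathbb{R}^d)$. Then $$\lim_{\alpha\to0^+}\alpha\int_{\mathbb{R}^d}\int_{\mathbb{R}^d}\frac{|f(x)-f(y)|^p}{|x-y|^d|x|^{\alpha}|y|^{\alpha}}\,dy\,dx=2\left|\mathbb{S}^{d-1}\right|\int_{\mathbb{R}^d}|f(x)|^p\,dx.$$
   Context: Functions are real-valued. $\left|\mathbb{S}^{d-1}\right|=\frac{2\pi^{d/2}}{\Gamma(d/2)}$ is the surface measure of the unit sphere in $\mathbb{R}^d$. *)

theory Defs
  imports "HOL-Analysis.Analysis"
begin

definition C1_compact_support :: "('a::euclidean_space \<Rightarrow> real) \<Rightarrow> bool" where
  "C1_compact_support f \<longleftrightarrow>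
     (\<exists>f' :: 'a \<Rightarrow> 'a \<Rightarrow>\<^sub>L real.
        (\<forall>x. (f has_derivative blinfun_apply (f' x)) (at x)) \<and> continuous_on UNIV f') \<and>
     compact (closure {x. f x \<noteq> 0})"

definition sphere_area :: "nat \<Rightarrow> real" where
  "sphere_area d = 2 * pi powr (real d / 2) / Gamma (real d / 2)"

(* The integrand is nonnegative, so the iterated integral is taken in [0, \<infinity>]; with this reading
   there is no default value for divergent integrals. The conventions t / 0 = 0 and 0 powr a = 0
   only affect, for each x, the points y = x and y = 0, and the point x = 0, all of measure zero. *)
definition weighted_energy :: "real \<Rightarrow> real \<Rightarrow> ('a::euclidean_space \<Rightarrow> real) \<Rightarrow> ennreal" where
  "weighted_energy p \<alpha> f =
     (\<integral>\<^sup>+ x. (\<integral>\<^sup>+ y. ennreal (\<bar>f x - f y\<bar> powr p /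
        (norm (x - y) ^ DIM('a) * norm x powr \<alpha> * norm y powr \<alpha>)) \<partial>lborel) \<partial>lborel)"

end

(* Let f vanish for |x| >= R and cut the domain at |x| = M > R. On |x|, |y| < M the Lipschitz bound
   makes the integral bounded uniformly in small alpha, so it is killed by the factor alpha. Since
   f x - f y vanishes for |x|, |y| >= M, by symmetry twice the region |x| < M <= |y| remains, where
   f y = 0 and |x - y| lies between (1 - R/M) |y| and (1 + R/M) |y|. There alpha times the integral
   over y is, up to these factors to the power -d, equal to |S^(d-1)| M^(-alpha) |f x|^p / |x|^alpha.
   Let first alpha tend to 0 and then M to infinity. *)

theory Submission
  imports Defs
begin

section \<open>Polar coordinates for radial integrands\<close>

lemma sphere_area_eq_unit_ball_vol:
  assumes "d > 0"
  shows "sphere_area d = real d * unit_ball_vol (real d)"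
proof -
  have Gamma: "Gamma (real d / 2 + 1) = real d / 2 * Gamma (real d / 2)"
    using assms by (intro Gamma_plus1) (auto elim!: nonpos_Ints_cases)
  then show ?thesis
    using assms unfolding sphere_area_def unit_ball_vol_def Gamma by simp
qed

lemma sphere_area_pos: "d > 0 \<Longrightarrow> sphere_area d > 0"
  by (simp add: sphere_area_eq_unit_ball_vol)

text \<open>Both measures agree on the half-lines \<open>{..a}\<close>, which generate the Borel
  sets and are stable under intersection: the mass of \<open>{..a}\<close> is the volume of a ball,
  and its derivative in the radius is the density by
  \<open>sphere_area_eq_unit_ball_vol\<close>.\<close>

lemma distr_norm_lborel:
  "distr (lborel :: 'a::euclidean_space measure) borel norm =
     density lborel (\<lambda>r. ennreal (sphere_area DIM('a) * r ^ (DIM('a) - 1)) * indicator {0..} r)"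
    (is "?L = density lborel ?g")
proof -
  have L: "emeasure ?L {..a} = emeasure (lborel :: 'a measure) (cball 0 a)" for a
    by (subst emeasure_distr) (auto intro!: arg_cong2[where f = emeasure])
  show ?thesis
  proof (rule measure_eqI_generator_eq[where E = "range atMost" and A = "\<lambda>i. {..real i}" and \<Omega> = UNIV])
    fix X assume "X \<in> range (atMost :: real \<Rightarrow> real set)"
    then obtain a where X: "X = {..a}" by auto
    have R: "emeasure (density lborel ?g) X =
        (\<integral>\<^sup>+r. ennreal (sphere_area DIM('a) * r ^ (DIM('a) - 1)) * indicator {0..a} r \<partial>lborel)"
      unfolding X by (subst emeasure_density) (auto intro!: nn_integral_cong simp: indicator_def)
    show "emeasure ?L X = emeasure (density lborel ?g) X"
    proof (cases "a \<ge> 0")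
      case True
      have deriv: "((\<lambda>r. unit_ball_vol DIM('a) * r ^ DIM('a)) has_real_derivative
          sphere_area DIM('a) * r ^ (DIM('a) - 1)) (at r)" for r
        by (auto intro!: derivative_eq_intros simp: sphere_area_eq_unit_ball_vol)
      have "emeasure (density lborel ?g) X = unit_ball_vol DIM('a) * a ^ DIM('a) - unit_ball_vol DIM('a) * 0 ^ DIM('a)"
        unfolding R using True sphere_area_pos[of "DIM('a)"] deriv
        by (intro nn_integral_FTC_Icc) (auto intro: has_field_derivative_at_within)
      then show ?thesis unfolding X L using True by (simp add: emeasure_cball)
    next
      case False
      then show ?thesis unfolding R unfolding X L by simp
    qed
  next
    show "sets ?L = sigma_sets UNIV (range atMost)"
      by (simp add: borel_eq_atMost)
    show "sets (density lborel ?g) = sigma_sets UNIV (range atMost)"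
      by (simp add: borel_eq_atMost)
    show "(\<Union>i. {..real i}) = UNIV"
      using real_arch_simple by auto
    show "emeasure ?L {..real i} \<noteq> \<infinity>" for i
      unfolding L by (simp add: emeasure_cball)
  qed (auto simp: Int_stable_def)
qed

lemma nn_integral_radial:
  fixes g :: "real \<Rightarrow> ennreal"
  assumes [measurable]: "g \<in> borel_measurable borel"
  shows "(\<integral>\<^sup>+x. g (norm x) \<partial>(lborel :: 'a::euclidean_space measure)) =
    (\<integral>\<^sup>+r. ennreal (sphere_area DIM('a) * r ^ (DIM('a) - 1)) * indicator {0..} r * g r \<partial>lborel)"
proof -
  have "(\<integral>\<^sup>+x. g (norm x) \<partial>(lborel :: 'a::euclidean_space measure)) = integral\<^sup>N (distr (lborel :: 'a measure) borel norm) g"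
    by (simp add: nn_integral_distr)
  then show ?thesis
    by (simp add: distr_norm_lborel nn_integral_density)
qed

text \<open>The Jacobian \<open>r ^ (DIM('a) - 1)\<close> is absorbed into the exponent of the
  power. A general set \<open>A\<close> of radii serves both balls and their complements.\<close>

lemma nn_integral_norm_powr_radial:
  assumes "((\<lambda>r. r powr (s + real DIM('a) - 1)) has_integral I) A" "A \<subseteq> {0..}" "A \<in> sets borel"
  shows "(\<integral>\<^sup>+x. ennreal (norm x powr s) * indicator A (norm x) \<partial>(lborel :: 'a::euclidean_space measure)) =
    ennreal (sphere_area DIM('a) * I)"
proof -
  have [measurable]: "A \<in> sets borel" by fact
  have eq: "r ^ (DIM('a) - 1) * r powr s = r powr (s + real DIM('a) - 1)" if "r > 0" for r :: real
    using that by (simp add: powr_realpow[symmetric] powr_add[symmetric] of_nat_diff Suc_leI algebra_simps)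
  have "AE r in lborel. r \<noteq> (0::real)"
    by (rule AE_lborel_singleton)
  then have "AE r in lborel. ennreal (sphere_area DIM('a) * r ^ (DIM('a) - 1)) * indicator {0..} r *
      (ennreal (r powr s) * indicator A r) =
      ennreal (sphere_area DIM('a) * r powr (s + real DIM('a) - 1)) * indicator A r"
  proof eventually_elim
    case (elim r)
    then show ?case
      using assms(2) sphere_area_pos[of "DIM('a)"] eq[of r]
      by (auto simp: indicator_def ennreal_mult'[symmetric] mult.assoc)
  qed
  then have "(\<integral>\<^sup>+x. ennreal (norm x powr s) * indicator A (norm x) \<partial>(lborel :: 'a::euclidean_space measure)) =
     (\<integral>\<^sup>+r. ennreal (sphere_area DIM('a) * r powr (s + real DIM('a) - 1)) * indicator A r \<partial>lborel)"
    by (subst nn_integral_radial[where g = "\<lambda>r. ennreal (r powr s) * indicator A r"])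
       (auto intro: nn_integral_cong_AE)
  also have "\<dots> = ennreal (sphere_area DIM('a) * I)"
    using assms(1) sphere_area_pos[of "DIM('a)"]
    by (intro nn_integral_has_integral_lebesgue') (auto intro: has_integral_mult_right)
  finally show ?thesis .
qed

lemma nn_integral_norm_powr_cball:
  assumes "s + real DIM('a) > 0" "M \<ge> 0"
  shows "(\<integral>\<^sup>+x. ennreal (norm x powr s) * indicator (cball 0 M) x \<partial>(lborel :: 'a::euclidean_space measure)) =
    ennreal (sphere_area DIM('a) * (M powr (s + real DIM('a)) / (s + real DIM('a))))"
proof -
  have "((\<lambda>r. r powr (s + real DIM('a) - 1)) has_integral (M powr (s + real DIM('a)) / (s + real DIM('a)))) {0..M}"
    using has_integral_powr_from_0[of "s + real DIM('a) - 1" M] assms by simp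
  from nn_integral_norm_powr_radial[OF this] show ?thesis
    by (simp add: indicator_def)
qed

text \<open>This is the source of the singularity in \<alpha>: the factor 1/\<alpha> obtained here
  is what the prefactor \<alpha> of the theorem compensates, leaving the sphere area in the
  limit.\<close>

lemma nn_integral_norm_powr_outside_ball:
  assumes "\<alpha> > 0" "M > 0"
  shows "(\<integral>\<^sup>+x. ennreal (norm x powr (- real DIM('a) - \<alpha>)) * indicator (- ball 0 M) x \<partial>(lborel :: 'a::euclidean_space measure)) =
    ennreal (sphere_area DIM('a) * (M powr (- \<alpha>) / \<alpha>))"
proof -
  have "((\<lambda>r. r powr ((- real DIM('a) - \<alpha>) + real DIM('a) - 1)) has_integral (M powr (- \<alpha>) / \<alpha>)) {M..}"
    using has_integral_powr_to_inf[of "- \<alpha> - 1" M] assms by simp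
  from nn_integral_norm_powr_radial[OF this] show ?thesis
    using assms by (simp add: indicator_def not_less)
qed

section \<open>Splitting a symmetric double integral\<close>

text \<open>Of the four products of \<open>B\<close> and \<open>- B\<close> the last carries no mass
  by \<open>zero\<close>; Tonelli and \<open>sym\<close> identify the two mixed ones.\<close>

lemma nn_integral_symmetric_split:
  fixes F :: "'a::euclidean_space \<Rightarrow> 'a \<Rightarrow> ennreal"
  assumes F [measurable]: "case_prod F \<in> borel_measurable (lborel \<Otimes>\<^sub>M lborel)"
    and B [measurable]: "B \<in> sets borel"
    and sym: "\<And>x y. F x y = F y x"
    and zero: "\<And>x y. x \<notin> B \<Longrightarrow> y \<notin> B \<Longrightarrow> F x y = 0"
  shows "(\<integral>\<^sup>+x. \<integral>\<^sup>+y. F x y \<partial>lborel \<partial>lborel) =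
     (\<integral>\<^sup>+x. \<integral>\<^sup>+y. F x y * indicator B x * indicator B y \<partial>lborel \<partial>lborel) +
     2 * (\<integral>\<^sup>+x. \<integral>\<^sup>+y. F x y * indicator B x * indicator (- B) y \<partial>lborel \<partial>lborel)"
proof -
  have split: "F x y = F x y * indicator B x * indicator B y + F x y * indicator B x * indicator (- B) y
     + F x y * indicator (- B) x * indicator B y" for x y
    using zero[of x y] by (auto simp: indicator_def)
  have "(\<integral>\<^sup>+x. \<integral>\<^sup>+y. F x y \<partial>lborel \<partial>lborel) =
     (\<integral>\<^sup>+x. \<integral>\<^sup>+y. F x y * indicator B x * indicator B y + F x y * indicator B x * indicator (- B) y
     + F x y * indicator (- B) x * indicator B y \<partial>lborel \<partial>lborel)"
    by (intro nn_integral_cong split)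
  also have "\<dots> = (\<integral>\<^sup>+x. \<integral>\<^sup>+y. F x y * indicator B x * indicator B y \<partial>lborel \<partial>lborel) +
     (\<integral>\<^sup>+x. \<integral>\<^sup>+y. F x y * indicator B x * indicator (- B) y \<partial>lborel \<partial>lborel) +
     (\<integral>\<^sup>+x. \<integral>\<^sup>+y. F x y * indicator (- B) x * indicator B y \<partial>lborel \<partial>lborel)"
    by (simp add: nn_integral_add)
  also have "(\<integral>\<^sup>+x. \<integral>\<^sup>+y. F x y * indicator (- B) x * indicator B y \<partial>lborel \<partial>lborel) =
     (\<integral>\<^sup>+x. \<integral>\<^sup>+y. F x y * indicator B x * indicator (- B) y \<partial>lborel \<partial>lborel)"
    by (subst lborel_pair.Fubini') (auto simp: indicator_def intro!: nn_integral_cong sym)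
  finally show ?thesis by (simp add: mult_2 add.assoc)
qed

section \<open>Bounds for compactly supported C^1 functions\<close>

lemma C1_compact_support_bounded:
  assumes "C1_compact_support f"
  obtains R where "R > 0" "\<And>x. norm x \<ge> R \<Longrightarrow> f x = 0"
proof -
  have "bounded {x. f x \<noteq> 0}"
    using assms closure_subset unfolding C1_compact_support_def
    by (metis bounded_subset compact_imp_bounded)
  then obtain b where b: "\<And>x. f x \<noteq> 0 \<Longrightarrow> norm x \<le> b"
    by (auto simp: bounded_iff)
  have "f x = 0" if "norm x \<ge> \<bar>b\<bar> + 1" for x
    using b[of x] that by fastforce
  then show ?thesis by (intro that[of "\<bar>b\<bar> + 1"]) auto
qed

lemma C1_compact_support_continuous:
  "C1_compact_support f \<Longrightarrow> continuous_on UNIV f"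
  unfolding C1_compact_support_def
  by (auto intro: has_derivative_continuous_on)

text \<open>Mean value inequality on the convex ball, where the continuous derivative is bounded by
  compactness.\<close>

lemma C1_compact_support_Lipschitz_on_cball:
  fixes f :: "'a::euclidean_space \<Rightarrow> real"
  assumes "C1_compact_support f"
  obtains L where "L > 0" "\<And>x y. norm x \<le> M \<Longrightarrow> norm y \<le> M \<Longrightarrow> \<bar>f x - f y\<bar> \<le> L * norm (x - y)"
proof -
  obtain f' :: "'a \<Rightarrow> 'a \<Rightarrow>\<^sub>L real" where
    f': "\<And>x. (f has_derivative blinfun_apply (f' x)) (at x)" "continuous_on UNIV f'"
    using assms unfolding C1_compact_support_def by blast
  have "compact (f' ` cball 0 M)"
    using f'(2) by (intro compact_continuous_image) (auto intro: continuous_on_subset)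
  then obtain L where L: "L > 0" "\<And>x. norm x \<le> M \<Longrightarrow> norm (f' x) \<le> L"
    by (auto dest!: compact_imp_bounded simp: bounded_pos)
  have "\<bar>f x - f y\<bar> \<le> L * norm (x - y)" if "norm x \<le> M" "norm y \<le> M" for x y
    using differentiable_bound[of "cball 0 M" f "\<lambda>x. blinfun_apply (f' x)" L x y] that f'(1) L(2)
    by (auto simp: norm_blinfun.rep_eq[symmetric] intro: has_derivative_at_withinI)
  with L(1) show ?thesis by (rule that)
qed

section \<open>Uniform bound for the near part\<close>

text \<open>Comparison at t = 1: up to 1 the more negative exponent gives the larger power, beyond 1
  the power is at most 1. This yields majorants independent of the exponent
  \<open>s\<close>.\<close>

lemma powr_neg_le_one_plus_powr:
  assumes "0 \<le> s" "s \<le> b" "0 \<le> (t::real)"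
  shows "t powr (- s) \<le> 1 + t powr (- b)"
proof (cases "t \<le> 1")
  case True
  then have "t powr (- s) \<le> t powr (- b)"
    using assms by (intro powr_mono') auto
  then show ?thesis by simp
next
  case False
  then have "t powr (- s) \<le> t powr 0"
    using assms by (intro powr_mono) auto
  then show ?thesis using False by (simp add: add_increasing2)
qed

text \<open>The two weights are decoupled by u v \<le> u^2 + v^2, which doubles the exponent;
  \<alpha> \<le> 1/4 keeps 2 \<alpha> within 1/2, an order of singularity that is integrable at the
  origin in every dimension.\<close>

lemma inverse_powr_mult_le:
  assumes "0 < \<alpha>" "\<alpha> \<le> 1/4" "0 \<le> s" "0 \<le> (t::real)"
  shows "1 / (s powr \<alpha> * t powr \<alpha>) \<le> (1 + s powr (- (1/2))) + (1 + t powr (- (1/2)))"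
proof -
  let ?u = "s powr (- \<alpha>)" and ?v = "t powr (- \<alpha>)"
  have sq: "r powr (- \<alpha>) * r powr (- \<alpha>) \<le> 1 + r powr (- (1/2))" if "0 \<le> r" for r :: real
    using powr_neg_le_one_plus_powr[of "2 * \<alpha>" "1/2" r] that assms by (simp add: powr_add[symmetric])
  have "1 / (s powr \<alpha> * t powr \<alpha>) = ?u * ?v"
    by (simp add: powr_minus field_simps)
  also have "\<dots> \<le> ?u * ?u + ?v * ?v"
    using sum_squares_bound[of ?u ?v] mult_nonneg_nonneg[of ?u ?v, OF powr_ge_zero powr_ge_zero]
    unfolding power2_eq_square by linarith
  also have "\<dots> \<le> (1 + s powr (- (1/2))) + (1 + t powr (- (1/2)))"
    using assms by (intro add_mono sq)
  finally show ?thesis .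
qed

abbreviation energy_density :: "real \<Rightarrow> real \<Rightarrow> ('a::euclidean_space \<Rightarrow> real) \<Rightarrow> 'a \<Rightarrow> 'a \<Rightarrow> real" where
  "energy_density p \<alpha> f x y \<equiv>
     \<bar>f x - f y\<bar> powr p / (norm (x - y) ^ DIM('a) * norm x powr \<alpha> * norm y powr \<alpha>)"

text \<open>The Lipschitz bound replaces the kernel of order -d at the diagonal by one of order p -
  d, which is locally integrable once p > 0. On the diagonal itself both sides are 0, as
  \<open>0 powr a = 0\<close>.\<close>

lemma energy_density_le_of_Lipschitz:
  fixes x y :: "'a::euclidean_space"
  assumes "p \<ge> 0" "0 < \<alpha>" "\<alpha> \<le> 1/4" "\<bar>f x - f y\<bar> \<le> L * norm (x - y)" "L > 0"
  shows "energy_density p \<alpha> f x y \<le> L powr p * norm (x - y) powr (p - real DIM('a)) *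
     ((1 + norm x powr (- (1/2))) + (1 + norm y powr (- (1/2))))"
proof (cases "x = y")
  case False
  then have pos: "norm (x - y) > 0" by simp
  have "\<bar>f x - f y\<bar> powr p \<le> (L * norm (x - y)) powr p"
    using assms by (intro powr_mono2) auto
  also have "\<dots> = L powr p * norm (x - y) powr p"
    using assms by (simp add: powr_mult)
  finally have *: "\<bar>f x - f y\<bar> powr p / norm (x - y) ^ DIM('a) \<le> L powr p * norm (x - y) powr p / norm (x - y) ^ DIM('a)"
    by (intro divide_right_mono) auto
  have "energy_density p \<alpha> f x y = (\<bar>f x - f y\<bar> powr p / norm (x - y) ^ DIM('a)) * (1 / (norm x powr \<alpha> * norm y powr \<alpha>))"
    by simp
  also have "\<dots> \<le> (L powr p * norm (x - y) powr p / norm (x - y) ^ DIM('a)) *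
     ((1 + norm x powr (- (1/2))) + (1 + norm y powr (- (1/2))))"
    using assms by (intro mult_mono * inverse_powr_mult_le) auto
  also have "L powr p * norm (x - y) powr p / norm (x - y) ^ DIM('a) = L powr p * norm (x - y) powr (p - real DIM('a))"
    using pos by (simp add: powr_diff powr_realpow)
  finally show ?thesis .
qed auto

lemma cball_in_borel [measurable]: "cball x r \<in> sets borel"
  by (simp add: borel_closed)

text \<open>The singularity at the origin has order 1/2, which is below the dimension.\<close>

lemma nn_integral_weight_cball_finite:
  "(\<integral>\<^sup>+x. ennreal (1 + norm x powr (- (1/2))) * indicator (cball 0 M) x \<partial>(lborel :: 'a::euclidean_space measure)) < \<infinity>"
proof (cases "M \<ge> 0")
  case True
  have d: "real DIM('a) \<ge> 1"
    using DIM_positive[where 'a = 'a] by linarith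
  have "(\<integral>\<^sup>+x. ennreal (1 + norm x powr (- (1/2))) * indicator (cball 0 M) x \<partial>(lborel :: 'a measure)) =
    (\<integral>\<^sup>+x. indicator (cball 0 M) x \<partial>(lborel :: 'a measure)) +
    (\<integral>\<^sup>+x. ennreal (norm x powr (- (1/2))) * indicator (cball 0 M) x \<partial>(lborel :: 'a measure))"
    by (subst nn_integral_add[symmetric]) (auto simp: distrib_right)
  also have "\<dots> < \<infinity>"
    using nn_integral_norm_powr_cball[where 'a = 'a, of "- (1/2)" M] d True
    by (simp add: emeasure_cball)
  finally show ?thesis .
qed (simp add: not_le)

lemma nn_integral_lborel_reflect:
  fixes x :: "'a::euclidean_space"
  assumes [measurable]: "h \<in> borel_measurable borel"
  shows "(\<integral>\<^sup>+y. h (x - y) \<partial>lborel) = (\<integral>\<^sup>+z. h z \<partial>lborel)"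
  \<comment> \<open>The measure on the right is rewritten as its image under the map sending z to x
    - z, whose Jacobian has absolute value 1.\<close>
  by (subst (2) lborel_affine[of "-1" x])
     (simp_all add: nn_integral_density nn_integral_distr)

text \<open>The Lipschitz majorant is a sum of two products, each of a weight at one point and a
  kernel in x - y. By invariance of Lebesgue measure each double integral is the integral of
  \<open>w\<close> times the integral of \<open>k\<close>, which is finite and independent of
  \<alpha>.\<close>

lemma near_energy_bounded:
  fixes f :: "'a::euclidean_space \<Rightarrow> real"
  assumes "p \<ge> 1" "C1_compact_support f" "M > 0"
  obtains C where "C \<ge> 0" "\<And>\<alpha>. 0 < \<alpha> \<Longrightarrow> \<alpha> \<le> 1/4 \<Longrightarrow>
     (\<integral>\<^sup>+x. \<integral>\<^sup>+y. ennreal (energy_density p \<alpha> f x y) * indicator (ball 0 M) x * indicator (ball 0 M) y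
        \<partial>lborel \<partial>lborel) \<le> ennreal C"
proof -
  obtain L where L: "L > 0" "\<And>x y. norm x \<le> M \<Longrightarrow> norm y \<le> M \<Longrightarrow> \<bar>f x - f y\<bar> \<le> L * norm (x - y)"
    using C1_compact_support_Lipschitz_on_cball[OF assms(2)] by blast
  define w :: "'a \<Rightarrow> ennreal" where "w x = ennreal (1 + norm x powr (- (1/2))) * indicator (cball 0 M) x" for x
  \<comment> \<open>The cutoff radius is 2 M because |x - y| \<le> 2 M for x and y in the ball of
    radius M.\<close>
  define k :: "'a \<Rightarrow> ennreal" where
    "k z = ennreal (L powr p) * (ennreal (norm z powr (p - real DIM('a))) * indicator (cball 0 (2 * M)) z)" for z
  have [measurable]: "w \<in> borel_measurable borel" "k \<in> borel_measurable borel"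
    unfolding w_def k_def by measurable
  have k_sym: "k (x - y) = k (y - x)" for x y
    by (simp add: k_def norm_minus_commute indicator_def)
  define C where "C = (\<integral>\<^sup>+x. w x \<partial>lborel) * (\<integral>\<^sup>+z. k z \<partial>lborel)"
  have "(\<integral>\<^sup>+z. k z \<partial>lborel) < \<infinity>"
    using nn_integral_norm_powr_cball[where 'a = 'a, of "p - real DIM('a)" "2 * M"] assms
    unfolding k_def by (subst nn_integral_cmult) (auto simp: ennreal_mult_less_top)
  moreover have "(\<integral>\<^sup>+x. w x \<partial>lborel) < \<infinity>"
    unfolding w_def by (rule nn_integral_weight_cball_finite)
  ultimately have C: "C + C < \<infinity>"
    by (simp add: C_def ennreal_mult_less_top)
  have wk: "(\<integral>\<^sup>+x. \<integral>\<^sup>+y. w x * k (x - y) \<partial>lborel \<partial>lborel) = C"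
    unfolding C_def by (simp add: nn_integral_cmult nn_integral_multc nn_integral_lborel_reflect)
  \<comment> \<open>Exchanging the order of integration gives the previous integral with x and y
    renamed, since \<open>k\<close> is even.\<close>
  then have wk': "(\<integral>\<^sup>+x. \<integral>\<^sup>+y. w y * k (x - y) \<partial>lborel \<partial>lborel) = C"
    by (subst lborel_pair.Fubini') (simp_all add: k_sym[of _ _])
  have "(\<integral>\<^sup>+x. \<integral>\<^sup>+y. ennreal (energy_density p \<alpha> f x y) * indicator (ball 0 M) x * indicator (ball 0 M) y
        \<partial>lborel \<partial>lborel) \<le> ennreal (enn2real (C + C))" if \<alpha>: "0 < \<alpha>" "\<alpha> \<le> 1/4" for \<alpha>
  proof -
    have "ennreal (energy_density p \<alpha> f x y) * indicator (ball 0 M) x * indicator (ball 0 M) y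
      \<le> w x * k (x - y) + w y * k (x - y)" for x y
    proof (cases "x \<in> ball 0 M \<and> y \<in> ball 0 M")
      case True
      then have xy: "norm x \<le> M" "norm y \<le> M" "norm (x - y) \<le> 2 * M"
        using norm_triangle_ineq4[of x y] by auto
      have "ennreal (energy_density p \<alpha> f x y) \<le> ennreal (L powr p * norm (x - y) powr (p - real DIM('a)) *
         ((1 + norm x powr (- (1/2))) + (1 + norm y powr (- (1/2)))))"
        using assms(1) \<alpha> L(1) by (intro ennreal_leI energy_density_le_of_Lipschitz L(2) xy) auto
      also have "\<dots> = (w x + w y) * k (x - y)"
        using xy by (simp add: w_def k_def ennreal_mult'[symmetric] ennreal_plus[symmetric] mult_ac del: ennreal_plus)
      finally show ?thesis using True by (simp add: distrib_right)
    qed auto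
    then have "(\<integral>\<^sup>+x. \<integral>\<^sup>+y. ennreal (energy_density p \<alpha> f x y) * indicator (ball 0 M) x * indicator (ball 0 M) y
        \<partial>lborel \<partial>lborel) \<le> (\<integral>\<^sup>+x. \<integral>\<^sup>+y. w x * k (x - y) + w y * k (x - y) \<partial>lborel \<partial>lborel)"
      by (intro nn_integral_mono)
    also have "\<dots> = C + C"
      by (simp add: nn_integral_add wk wk')
    finally show ?thesis using C by simp
  qed
  then show ?thesis by (intro that[of "enn2real (C + C)"]) auto
qed

section \<open>The weighted integral of |f|^p as \<alpha> tends to 0\<close>

text \<open>Dominated convergence: for \<alpha> \<le> 1/2 the weight is at most
  \<open>1 + norm x powr (- (1/2))\<close>, while f is bounded with bounded support. As the limit is
  a Bochner integral, the integrability of |f|^p is established on the way.\<close>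

lemma nn_integral_powr_weighted_tendsto:
  fixes f :: "'a::euclidean_space \<Rightarrow> real"
  assumes f: "C1_compact_support f" and p: "p \<ge> 0"
  shows "((\<lambda>\<alpha>. \<integral>\<^sup>+x. ennreal (\<bar>f x\<bar> powr p / norm x powr \<alpha>) \<partial>lborel)
     \<longlongrightarrow> ennreal (\<integral>x. \<bar>f x\<bar> powr p \<partial>lborel)) (at_right 0)"
proof -
  have cont: "continuous_on UNIV f"
    using f by (rule C1_compact_support_continuous)
  have [measurable]: "f \<in> borel_measurable borel"
    using cont by (rule borel_measurable_continuous_onI)
  obtain R where R: "R > 0" "\<And>x. norm x \<ge> R \<Longrightarrow> f x = 0"
    using C1_compact_support_bounded[OF f] by blast
  define W :: "'a \<Rightarrow> ennreal" where
    "W x = ennreal (1 + norm x powr (- (1/2))) * indicator (cball 0 R) x" for x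
  have [measurable]: "W \<in> borel_measurable borel"
    unfolding W_def by measurable
  have W: "(\<integral>\<^sup>+x. W x \<partial>lborel) < \<infinity>"
    unfolding W_def by (rule nn_integral_weight_cball_finite)
  have "compact (f ` cball 0 R)"
    using cont by (intro compact_continuous_image) (auto intro: continuous_on_subset)
  then obtain B where B: "B > 0" "\<And>x. norm x \<le> R \<Longrightarrow> \<bar>f x\<bar> \<le> B"
    by (auto dest!: compact_imp_bounded simp: bounded_pos)
  have f_zero: "\<bar>f x\<bar> powr p = 0" if "\<not> norm x \<le> R" for x
    using that R(2)[of x] by simp
  have f_le: "\<bar>f x\<bar> powr p \<le> B powr p" if "norm x \<le> R" for x
    using B(2)[OF that] p by (intro powr_mono2) auto
  have dom_finite: "(\<integral>\<^sup>+x. ennreal (B powr p) * W x \<partial>lborel) < \<infinity>"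
    using W by (simp add: nn_integral_cmult ennreal_mult_less_top)
  have dom: "ennreal (\<bar>f x\<bar> powr p / norm x powr \<alpha>) \<le> ennreal (B powr p) * W x"
    if "0 \<le> \<alpha>" "\<alpha> \<le> 1/2" for x \<alpha>
  proof (cases "norm x \<le> R")
    case True
    have "\<bar>f x\<bar> powr p / norm x powr \<alpha> = \<bar>f x\<bar> powr p * norm x powr (- \<alpha>)"
      by (simp add: powr_minus field_simps)
    also have "\<dots> \<le> B powr p * (1 + norm x powr (- (1/2)))"
      using that True by (intro mult_mono f_le powr_neg_le_one_plus_powr) auto
    finally show ?thesis
      using True by (simp add: W_def ennreal_mult'[symmetric] ennreal_leI del: ennreal_plus)
  qed (simp add: f_zero)
  have AE_pos: "AE x in lborel. x \<noteq> (0::'a)"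
    by (rule AE_lborel_singleton)
  \<comment> \<open>The case \<alpha> = 0 of \<open>dom\<close> gives the integrability of |f|^p.
    The origin is left out because \<open>0 powr 0 = 0\<close> turns the quotient there into
    0.\<close>
  have "ennreal (\<bar>f x\<bar> powr p) \<le> ennreal (B powr p) * W x" if "x \<noteq> 0" for x
    using dom[of 0 x] that by simp
  then have "(\<integral>\<^sup>+x. ennreal (\<bar>f x\<bar> powr p) \<partial>lborel) \<le> (\<integral>\<^sup>+x. ennreal (B powr p) * W x \<partial>lborel)"
    using AE_pos by (intro nn_integral_mono_AE) (auto elim!: eventually_mono)
  then have "integrable lborel (\<lambda>x. \<bar>f x\<bar> powr p)"
    using dom_finite by (intro integrableI_bounded) (auto intro: le_less_trans)
  then have I: "(\<integral>\<^sup>+x. ennreal (\<bar>f x\<bar> powr p) \<partial>lborel) = ennreal (\<integral>x. \<bar>f x\<bar> powr p \<partial>lborel)"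
    by (intro nn_integral_eq_integral) auto
  \<comment> \<open>Within \<open>{0..1/2}\<close> every sequence approaching 0 stays where
    \<open>dom\<close> applies; the filter coincides with \<open>at_right 0\<close>.\<close>
  have "((\<lambda>\<alpha>. \<integral>\<^sup>+x. ennreal (\<bar>f x\<bar> powr p / norm x powr \<alpha>) \<partial>lborel)
     \<longlongrightarrow> (\<integral>\<^sup>+x. ennreal (\<bar>f x\<bar> powr p) \<partial>lborel)) (at 0 within {0..1/2})"
    unfolding tendsto_at_iff_sequentially comp_def
  proof (intro allI impI)
    fix X :: "nat \<Rightarrow> real" assume X: "\<forall>i. X i \<in> {0..1/2} - {0}" "X \<longlonglongrightarrow> 0"
    show "(\<lambda>i. \<integral>\<^sup>+x. ennreal (\<bar>f x\<bar> powr p / norm x powr X i) \<partial>lborel)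
       \<longlonglongrightarrow> (\<integral>\<^sup>+x. ennreal (\<bar>f x\<bar> powr p) \<partial>lborel)"
    proof (rule nn_integral_dominated_convergence[where w = "\<lambda>x. ennreal (B powr p) * W x"])
      show "AE x in lborel. ennreal (\<bar>f x\<bar> powr p / norm x powr X i) \<le> ennreal (B powr p) * W x" for i
        using X(1)[rule_format, of i] by (intro AE_I2 dom) auto
      show "AE x in lborel. (\<lambda>i. ennreal (\<bar>f x\<bar> powr p / norm x powr X i)) \<longlonglongrightarrow> ennreal (\<bar>f x\<bar> powr p)"
        using AE_pos
      proof eventually_elim
        case (elim x)
        then have "(\<lambda>i. \<bar>f x\<bar> powr p / norm x powr X i) \<longlonglongrightarrow> \<bar>f x\<bar> powr p / norm x powr 0"
          using X(2) by (intro tendsto_intros) auto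
        then show ?case using elim by (intro tendsto_ennrealI) simp
      qed
    qed (use dom_finite in auto)
  qed
  then show ?thesis
    by (simp add: I at_within_Icc_at_right)
qed

section \<open>The far part\<close>

text \<open>\<open>g\<close> is the integrand with |x - y| replaced by |y|, hence a function of x
  times a function of y; the cost is a factor that tends to 1 as M grows.\<close>

lemma energy_density_far_bounds:
  fixes f :: "'a::euclidean_space \<Rightarrow> real" and x y :: 'a and p \<alpha> :: real
  assumes R: "0 < R" "R < M" "\<And>x. norm x \<ge> R \<Longrightarrow> f x = 0" and y: "norm y \<ge> M"
  defines "g \<equiv> \<bar>f x\<bar> powr p / norm x powr \<alpha> * norm y powr (- real DIM('a) - \<alpha>)"
  shows "energy_density p \<alpha> f x y \<le> 1 / (1 - R / M) ^ DIM('a) * g"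
    and "1 / (1 + R / M) ^ DIM('a) * g \<le> energy_density p \<alpha> f x y"
proof -
  have fy: "f y = 0" using R(2,3) y by force
  have ny: "norm y > 0" using R y by linarith
  define a where "a = \<bar>f x\<bar> powr p / (norm x powr \<alpha> * norm y powr \<alpha>)"
  have a: "a \<ge> 0" by (simp add: a_def)
  \<comment> \<open>Stated for every \<open>c\<close> to serve both \<open>1 - R / M\<close> and
    \<open>1 + R / M\<close>: the claims reduce to comparing |x - y| with c |y|.\<close>
  have g: "1 / c ^ DIM('a) * g = a * (1 / (c * norm y) ^ DIM('a))" for c
    using ny by (simp add: g_def a_def powr_diff powr_minus powr_realpow power_mult_distrib field_simps)
  have E: "energy_density p \<alpha> f x y = a * (1 / norm (x - y) ^ DIM('a))"
    by (simp add: fy a_def)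
  have "energy_density p \<alpha> f x y \<le> 1 / (1 - R / M) ^ DIM('a) * g \<and>
    1 / (1 + R / M) ^ DIM('a) * g \<le> energy_density p \<alpha> f x y"
  proof (cases "f x = 0")
    case False
    then have x: "norm x < R" using R(3)[of x] by force
    \<comment> \<open>Here |y| \<ge> M enters: the absolute error R becomes the relative error R /
      M.\<close>
    have "R \<le> R / M * norm y"
      using R y by (simp add: field_simps)
    then have l: "(1 - R / M) * norm y \<le> norm (x - y)" and u: "norm (x - y) \<le> (1 + R / M) * norm y"
      using x norm_triangle_ineq4[of x y] norm_triangle_ineq2[of y x]
      by (auto simp: algebra_simps norm_minus_commute)
    have pm: "0 < 1 - R / M" "0 < 1 + R / M" using R by (simp_all add: add_pos_pos)
    from pm(1) ny have pos: "0 < (1 - R / M) * norm y" by simp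
    with l have "0 < norm (x - y)" by linarith
    with pos l u have "1 / norm (x - y) ^ DIM('a) \<le> 1 / ((1 - R / M) * norm y) ^ DIM('a)"
      and "1 / ((1 + R / M) * norm y) ^ DIM('a) \<le> 1 / norm (x - y) ^ DIM('a)"
      using ny pm(2) by (auto intro!: divide_left_mono power_mono mult_pos_pos zero_less_power)
    then show ?thesis
      unfolding E g using a by (intro conjI mult_left_mono) simp_all
  qed (simp add: fy g_def)
  then show "energy_density p \<alpha> f x y \<le> 1 / (1 - R / M) ^ DIM('a) * g"
    and "1 / (1 + R / M) ^ DIM('a) * g \<le> energy_density p \<alpha> f x y" by auto
qed

lemma nn_integral_far_product:
  fixes f :: "'a::euclidean_space \<Rightarrow> real"
  assumes f [measurable]: "f \<in> borel_measurable borel"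
    and "0 < \<alpha>" "0 < M" "0 \<le> c" and zero: "\<And>x. norm x \<ge> M \<Longrightarrow> f x = 0"
  shows "(\<integral>\<^sup>+x. \<integral>\<^sup>+y. ennreal (c * (\<bar>f x\<bar> powr p / norm x powr \<alpha> * norm y powr (- real DIM('a) - \<alpha>))) *
       indicator (ball 0 M) x * indicator (- ball (0::'a) M) y \<partial>lborel \<partial>lborel) =
     ennreal (c * sphere_area DIM('a) * (M powr (- \<alpha>) / \<alpha>)) *
       (\<integral>\<^sup>+x. ennreal (\<bar>f x\<bar> powr p / norm x powr \<alpha>) \<partial>lborel)"
proof -
  define g where "g x = ennreal (\<bar>f x\<bar> powr p / norm x powr \<alpha>)" for x
  define h where "h y = ennreal (norm y powr (- real DIM('a) - \<alpha>)) * indicator (- ball 0 M) y" for y :: 'a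
  have [measurable]: "ball (0::'a) M \<in> sets borel"
    by (simp add: borel_open)
  have [measurable]: "g \<in> borel_measurable borel" "h \<in> borel_measurable borel"
    unfolding g_def h_def by measurable
  have factor: "ennreal (c * (\<bar>f x\<bar> powr p / norm x powr \<alpha> * norm y powr (- real DIM('a) - \<alpha>))) *
       indicator (ball 0 M) x * indicator (- ball 0 M) y = ennreal c * g x * h y" for x y :: 'a
    using zero[of x] assms(4) by (auto simp: g_def h_def ennreal_mult[symmetric] indicator_def)
  have "(\<integral>\<^sup>+x. \<integral>\<^sup>+y. ennreal (c * (\<bar>f x\<bar> powr p / norm x powr \<alpha> * norm y powr (- real DIM('a) - \<alpha>))) *
       indicator (ball 0 M) x * indicator (- ball (0::'a) M) y \<partial>lborel \<partial>lborel) =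
     (\<integral>\<^sup>+x. \<integral>\<^sup>+y. ennreal c * g x * h y \<partial>lborel \<partial>lborel)"
    by (intro nn_integral_cong factor)
  also have "\<dots> = ennreal c * (\<integral>\<^sup>+y. h y \<partial>lborel) * (\<integral>\<^sup>+x. g x \<partial>lborel)"
    by (simp add: nn_integral_cmult nn_integral_multc mult_ac)
  also have "ennreal c * (\<integral>\<^sup>+y. h y \<partial>lborel) = ennreal (c * sphere_area DIM('a) * (M powr (- \<alpha>) / \<alpha>))"
    unfolding h_def using assms sphere_area_pos[of "DIM('a)"]
    by (subst nn_integral_norm_powr_outside_ball) (auto simp: ennreal_mult[symmetric] mult.assoc)
  finally show ?thesis by (simp add: g_def)
qed

section \<open>Two-sided bounds for the energy\<close>

text \<open>The energy is the near part plus twice the far part. The lower bound discards the near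
  part and so holds for every \<alpha> > 0; the upper bound needs \<alpha> \<le> 1/4 for the uniform
  constant \<open>C\<close>, which may depend on M but not on \<alpha>.\<close>

lemma weighted_energy_bounds:
  fixes f :: "'a::euclidean_space \<Rightarrow> real"
  assumes f: "C1_compact_support f" and p: "p \<ge> 1"
    and R: "0 < R" "R < M" "\<And>x. norm x \<ge> R \<Longrightarrow> f x = 0"
  defines "J \<equiv> \<lambda>\<alpha>. \<integral>\<^sup>+x. ennreal (\<bar>f x\<bar> powr p / norm x powr \<alpha>) \<partial>lborel"
  obtains C where "C \<ge> 0"
    "\<And>\<alpha>. 0 < \<alpha> \<Longrightarrow> \<alpha> \<le> 1/4 \<Longrightarrow> ennreal \<alpha> * weighted_energy p \<alpha> f \<le>
        ennreal (\<alpha> * C) + ennreal (2 * sphere_area DIM('a) / (1 - R / M) ^ DIM('a) * M powr (- \<alpha>)) * J \<alpha>"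
    "\<And>\<alpha>. 0 < \<alpha> \<Longrightarrow> ennreal (2 * sphere_area DIM('a) / (1 + R / M) ^ DIM('a) * M powr (- \<alpha>)) * J \<alpha>
        \<le> ennreal \<alpha> * weighted_energy p \<alpha> f"
proof -
  let ?B = "ball (0::'a) M"
  have M: "M > 0" using R by simp
  have [measurable]: "f \<in> borel_measurable borel"
    using C1_compact_support_continuous[OF f] by (rule borel_measurable_continuous_onI)
  define near where "near \<alpha> = (\<integral>\<^sup>+x. \<integral>\<^sup>+y. ennreal (energy_density p \<alpha> f x y) *
    indicator ?B x * indicator ?B y \<partial>lborel \<partial>lborel)" for \<alpha>
  define far where "far \<alpha> = (\<integral>\<^sup>+x. \<integral>\<^sup>+y. ennreal (energy_density p \<alpha> f x y) *
    indicator ?B x * indicator (- ?B) y \<partial>lborel \<partial>lborel)" for \<alpha>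
  have zero: "f x = 0" if "norm x \<ge> M" for x
    using that R(2,3) by simp
  have split: "weighted_energy p \<alpha> f = near \<alpha> + 2 * far \<alpha>" for \<alpha>
    unfolding weighted_energy_def near_def far_def
    by (rule nn_integral_symmetric_split)
       (auto simp: zero abs_minus_commute norm_minus_commute mult_ac)
  have far_eq: "(\<integral>\<^sup>+x. \<integral>\<^sup>+y. ennreal (c * (\<bar>f x\<bar> powr p / norm x powr \<alpha> * norm y powr (- real DIM('a) - \<alpha>))) *
       indicator ?B x * indicator (- ?B) y \<partial>lborel \<partial>lborel) =
     ennreal (c * sphere_area DIM('a) * (M powr (- \<alpha>) / \<alpha>)) * J \<alpha>" if "0 < \<alpha>" "0 \<le> c" for c \<alpha>
    unfolding J_def using that M zero by (intro nn_integral_far_product) auto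
  \<comment> \<open>The prefactor \<alpha> cancels the 1/\<alpha> of the outer integral; the 2
    counts the two mixed regions.\<close>
  have scale: "ennreal \<alpha> * (2 * (ennreal (c * sphere_area DIM('a) * (M powr (- \<alpha>) / \<alpha>)) * J \<alpha>)) =
    ennreal (2 * sphere_area DIM('a) * c * M powr (- \<alpha>)) * J \<alpha>" if "0 < \<alpha>" "0 \<le> c" for c \<alpha>
  proof -
    have "ennreal \<alpha> * (2 * (ennreal (c * sphere_area DIM('a) * (M powr (- \<alpha>) / \<alpha>)) * J \<alpha>)) =
      (ennreal \<alpha> * ennreal 2 * ennreal (c * sphere_area DIM('a) * (M powr (- \<alpha>) / \<alpha>))) * J \<alpha>"
      by (simp add: mult_ac)
    also have "ennreal \<alpha> * ennreal 2 * ennreal (c * sphere_area DIM('a) * (M powr (- \<alpha>) / \<alpha>)) =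
      ennreal (2 * sphere_area DIM('a) * c * M powr (- \<alpha>))"
      using that sphere_area_pos[of "DIM('a)"]
      by (subst ennreal_mult[symmetric], simp, simp)+ (simp add: field_simps)
    finally show ?thesis .
  qed
  obtain C where C: "C \<ge> 0" "\<And>\<alpha>. 0 < \<alpha> \<Longrightarrow> \<alpha> \<le> 1/4 \<Longrightarrow> near \<alpha> \<le> ennreal C"
    using near_energy_bounded[OF p f M] unfolding near_def by blast
  show ?thesis
  proof (rule that[OF C(1)])
    fix \<alpha> :: real assume \<alpha>: "0 < \<alpha>"
    let ?c = "1 / (1 + R / M) ^ DIM('a)"
    have "(\<integral>\<^sup>+x. \<integral>\<^sup>+y. ennreal (?c * (\<bar>f x\<bar> powr p / norm x powr \<alpha> * norm y powr (- real DIM('a) - \<alpha>))) *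
       indicator ?B x * indicator (- ?B) y \<partial>lborel \<partial>lborel) \<le> far \<alpha>"
      unfolding far_def using energy_density_far_bounds(2)[where f = f, OF R, where p = p and \<alpha> = \<alpha>]
      by (intro nn_integral_mono) (auto simp: indicator_def simp del: times_divide_eq_left intro!: ennreal_leI)
    then have "ennreal (?c * sphere_area DIM('a) * (M powr (- \<alpha>) / \<alpha>)) * J \<alpha> \<le> far \<alpha>"
      using far_eq[of \<alpha> ?c] \<alpha> R by simp
    then have "ennreal \<alpha> * (2 * (ennreal (?c * sphere_area DIM('a) * (M powr (- \<alpha>) / \<alpha>)) * J \<alpha>)) \<le>
        ennreal \<alpha> * (near \<alpha> + 2 * far \<alpha>)"
      by (intro mult_left_mono add_increasing) auto
    then show "ennreal (2 * sphere_area DIM('a) / (1 + R / M) ^ DIM('a) * M powr (- \<alpha>)) * J \<alpha>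
        \<le> ennreal \<alpha> * weighted_energy p \<alpha> f"
      using scale[of \<alpha> ?c] \<alpha> R by (simp add: split)
  next
    fix \<alpha> :: real assume \<alpha>: "0 < \<alpha>" "\<alpha> \<le> 1/4"
    let ?c = "1 / (1 - R / M) ^ DIM('a)"
    have c: "?c \<ge> 0" using R by simp
    have "far \<alpha> \<le> (\<integral>\<^sup>+x. \<integral>\<^sup>+y. ennreal (?c * (\<bar>f x\<bar> powr p / norm x powr \<alpha> * norm y powr (- real DIM('a) - \<alpha>))) *
       indicator ?B x * indicator (- ?B) y \<partial>lborel \<partial>lborel)"
      unfolding far_def using energy_density_far_bounds(1)[where f = f, OF R, where p = p and \<alpha> = \<alpha>]
      by (intro nn_integral_mono) (auto simp: indicator_def simp del: times_divide_eq_left intro!: ennreal_leI)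
    then have "far \<alpha> \<le> ennreal (?c * sphere_area DIM('a) * (M powr (- \<alpha>) / \<alpha>)) * J \<alpha>"
      using far_eq[of \<alpha> ?c] \<alpha> c by simp
    then have "ennreal \<alpha> * (near \<alpha> + 2 * far \<alpha>) \<le> ennreal \<alpha> * (ennreal C +
        2 * (ennreal (?c * sphere_area DIM('a) * (M powr (- \<alpha>) / \<alpha>)) * J \<alpha>))"
      using \<alpha> by (intro mult_left_mono add_mono C(2)) auto
    then show "ennreal \<alpha> * weighted_energy p \<alpha> f \<le>
        ennreal (\<alpha> * C) + ennreal (2 * sphere_area DIM('a) / (1 - R / M) ^ DIM('a) * M powr (- \<alpha>)) * J \<alpha>"
      using scale[of \<alpha> ?c] \<alpha> c C(1) by (simp add: split distrib_left ennreal_mult)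
  qed
qed

section \<open>Passage to the limit in \<alpha>, then in M\<close>

theorem theorem3:
  fixes f :: "'a::euclidean_space \<Rightarrow> real" and p :: real
  assumes "p \<ge> 1"
    and "C1_compact_support f"
  shows "((\<lambda>\<alpha>::real. ennreal \<alpha> * weighted_energy p \<alpha> f) \<longlongrightarrow>
           ennreal (2 * sphere_area DIM('a) * (\<integral>x. \<bar>f x\<bar> powr p \<partial>lborel))) (at_right 0)"
proof -
  define I where "I = (\<integral>x. \<bar>f x\<bar> powr p \<partial>lborel)"
  define S where "S = sphere_area DIM('a)"
  define J where "J \<alpha> = (\<integral>\<^sup>+x. ennreal (\<bar>f x\<bar> powr p / norm x powr \<alpha>) \<partial>lborel)" for \<alpha>
  have I: "I \<ge> 0" and S: "S > 0"
    by (auto simp: I_def S_def sphere_area_pos)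
  obtain R where R: "R > 0" "\<And>x. norm x \<ge> R \<Longrightarrow> f x = 0"
    using C1_compact_support_bounded[OF assms(2)] by blast
  \<comment> \<open>Since \<open>M powr (- \<alpha>)\<close> tends to 1, M survives only through
    \<open>k\<close>, which will be (1 + R/M)^d or (1 - R/M)^d.\<close>
  have far_lim: "((\<lambda>\<alpha>. ennreal (2 * S / k * M powr (- \<alpha>)) * J \<alpha>) \<longlongrightarrow> ennreal (2 * S / k * I)) (at_right 0)"
    if "k > 0" "M > 0" for k M
  proof -
    have "((\<lambda>\<alpha>. 2 * S / k * M powr (- \<alpha>)) \<longlongrightarrow> 2 * S / k * M powr (- 0)) (at_right 0)"
      using that by (intro tendsto_intros) auto
    then have "((\<lambda>\<alpha>. ennreal (2 * S / k * M powr (- \<alpha>)) * J \<alpha>) \<longlongrightarrow> ennreal (2 * S / k * M powr (- 0)) * ennreal I) (at_right 0)"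
      unfolding J_def I_def
      by (intro tendsto_mult_ennreal tendsto_ennrealI nn_integral_powr_weighted_tendsto) (use assms in auto)
    then show ?thesis
      using that I S by (simp add: ennreal_mult'[symmetric])
  qed
  have ratio: "((\<lambda>M. R / M) \<longlongrightarrow> 0) at_top"
    by (intro tendsto_divide_0[OF tendsto_const] filterlim_at_top_imp_at_infinity filterlim_ident)
  have lower: "((\<lambda>M. ennreal (2 * S / (1 + R / M) ^ DIM('a) * I)) \<longlongrightarrow> ennreal (2 * S / (1 + 0) ^ DIM('a) * I)) at_top"
    by (intro tendsto_intros ratio) auto
  have upper: "((\<lambda>M. ennreal (2 * S / (1 - R / M) ^ DIM('a) * I)) \<longlongrightarrow> ennreal (2 * S / (1 - 0) ^ DIM('a) * I)) at_top"
    by (intro tendsto_intros ratio) auto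
  have small: "\<forall>\<^sub>F \<alpha> in at_right 0. 0 < \<alpha> \<and> \<alpha> \<le> (1/4::real)"
    unfolding eventually_at_right_field by (intro exI[of _ "1/4"]) auto
  show ?thesis
    unfolding I_def[symmetric] S_def[symmetric]
  proof (rule order_tendstoI)
    fix a assume "a < ennreal (2 * S * I)"
    then have "\<forall>\<^sub>F M in at_top. a < ennreal (2 * S / (1 + R / M) ^ DIM('a) * I)"
      using order_tendstoD(1)[OF lower] by simp
    \<comment> \<open>M is fixed before \<alpha> moves: the inequality remains strict at this M, so
      \<open>far_lim\<close> carries it over to all small \<alpha>.\<close>
    then obtain M where M: "M > R" "a < ennreal (2 * S / (1 + R / M) ^ DIM('a) * I)"
      using eventually_happens'[OF trivial_limit_at_top_linorder eventually_conj[OF eventually_gt_at_top[of R]]]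
      by blast
    have "\<forall>\<^sub>F \<alpha> in at_right 0. a < ennreal (2 * S / (1 + R / M) ^ DIM('a) * M powr (- \<alpha>)) * J \<alpha>"
      using M R(1) by (intro order_tendstoD(1)[OF far_lim]) (auto intro!: zero_less_power add_pos_pos)
    then show "\<forall>\<^sub>F \<alpha> in at_right 0. a < ennreal \<alpha> * weighted_energy p \<alpha> f"
      using small
    proof eventually_elim
      case (elim \<alpha>)
      have "ennreal (2 * S / (1 + R / M) ^ DIM('a) * M powr (- \<alpha>)) * J \<alpha> \<le> ennreal \<alpha> * weighted_energy p \<alpha> f"
      proof (rule weighted_energy_bounds[OF assms(2,1) R(1) M(1), folded S_def J_def], goal_cases)
        case (2 C)
        show ?case using elim(2) by (intro 2(3)) simp
      qed (rule R(2))
      with elim(1) show ?case by (rule less_le_trans)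
    qed
  next
    fix a assume "ennreal (2 * S * I) < a"
    then have "\<forall>\<^sub>F M in at_top. ennreal (2 * S / (1 - R / M) ^ DIM('a) * I) < a"
      using order_tendstoD(2)[OF upper] by simp
    then obtain M where M: "M > R" "ennreal (2 * S / (1 - R / M) ^ DIM('a) * I) < a"
      using eventually_happens'[OF trivial_limit_at_top_linorder eventually_conj[OF eventually_gt_at_top[of R]]]
      by blast
    obtain C where C: "C \<ge> 0" "\<And>\<alpha>. 0 < \<alpha> \<Longrightarrow> \<alpha> \<le> 1/4 \<Longrightarrow> ennreal \<alpha> * weighted_energy p \<alpha> f \<le>
        ennreal (\<alpha> * C) + ennreal (2 * S / (1 - R / M) ^ DIM('a) * M powr (- \<alpha>)) * J \<alpha>"
    proof (rule weighted_energy_bounds[OF assms(2,1) R(1) M(1), folded S_def J_def], goal_cases)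
      case (2 C)
      show thesis by (rule 2(1)[OF 2(2)], rule 2(3))
    qed (rule R(2))
    \<comment> \<open>With M fixed, \<open>C\<close> is a constant and the near contribution
      \<alpha> C disappears in the limit.\<close>
    have "((\<lambda>\<alpha>. ennreal (\<alpha> * C) + ennreal (2 * S / (1 - R / M) ^ DIM('a) * M powr (- \<alpha>)) * J \<alpha>)
        \<longlongrightarrow> ennreal (0 * C) + ennreal (2 * S / (1 - R / M) ^ DIM('a) * I)) (at_right 0)"
      using M R(1) by (intro tendsto_add tendsto_ennrealI tendsto_mult far_lim tendsto_ident_at tendsto_const) auto
    then have "\<forall>\<^sub>F \<alpha> in at_right 0.
        ennreal (\<alpha> * C) + ennreal (2 * S / (1 - R / M) ^ DIM('a) * M powr (- \<alpha>)) * J \<alpha> < a"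
      using M(2) by (intro order_tendstoD(2)) auto
    then show "\<forall>\<^sub>F \<alpha> in at_right 0. ennreal \<alpha> * weighted_energy p \<alpha> f < a"
      using small
    proof eventually_elim
      case (elim \<alpha>)
      then show ?case using C(2)[of \<alpha>] by (auto intro: le_less_trans)
    qed
  qed
qed

end
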